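(* Let $F(x)=f(x)+\delta_C(x)+\Phi(|x|)$ be as in the context, and let $\{\theta_k\}_{k\ge 0}\subset(0,1]$ be chosen so that $$\sup_{k\ge 1}\{\theta_k^2(1-\theta_{k-1})^2-\theta_{k-1}^2\}<0.$$ Let $\{x^k\},\{y^k\},\{z^k\}$ be the sequences generated by the algorithm IRL$_1e_2$ described in the context, and let $H_1(x,y):=f(x)+\delta_C(x)+\Phi(|x|)+\frac{L}{2}\|x-y\|^2$. Then the following statements hold: (i) $\{H_1(x^k,x^{k-1})\}_{k\ge 1}$ is a nonincreasing convergent sequence. (ii) $\lim_{k\to\infty}\max\{\|z^{k+1}-x^k\|,\|z^{k+1}-y^k\|,\|z^{k+1}-z^k\|\}=0$. (iii) The sequence $\{z^k\}$ is bounded. (iv) Any accumulation point $z^*$ of $\{z^k\}$ is a stationary point of the problem $\min_{x\in\mathbb{R}^n}F(x)$, i.e., $0\in\partial F(z^* )$.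
   Context: Setting. $\mathbb{R}^n$ carries the Euclidean inner product $\langle\cdot,\cdot\rangle$ and norm $\|\cdot\|$. The function $f:\mathbb{R}^n\to\mathbb{R}$ is convex and continuously differentiable, and its gradient is Lipschitz continuous with modulus $L>0$. $C\subseteq\mathbb{R}^n$ is a nonempty closed convex set and $\delta_C$ is its indicator function ($0$ on $C$, $+\infty$ off $C$). $\Phi(y)=\sum_{i=1}^n\phi(y_i)$ for $y\in\mathbb{R}^n_+$, where $\phi:\mathbb{R}_+\to\mathbb{R}_+$ is a continuous concave function with $\phi(0)=0$ that is continuously differentiable on $(0,\infty)$ and such that the limit $\ell:=\lim_{t\downarrow 0}\phi'(t)$ exists (as a finite real number). For $x\in\mathbb{R}^n$, $|x|$ is the vector with entries $|x_i|$. It is assumed that $F(x):=f(x)+\delta_C(x)+\Phi(|x|)$ is level-bounded (all sets $\{x: F(x)\le\alpha\}$, $\alpha\in\mathbb{R}$, are bounded). Notation. $\phi'_+(t):=\lim_{h\downarrow 0}\frac{\phi(t+h)-\phi(t)}{h}$ is the right-hand derivative, and $\Phi'_+(|y|):=(\phi'_+(|y_1|),\dots,\phi'_+(|y_n|))$. For a proper function $g:\mathbb{R}^n\to(-\infty,\infty]$ and $x$ with $g(x)<\infty$, the regular subdifferential is $\hat\partial g(x)=\{\zeta:\liminf_{z\to x,z\ne x}\frac{g(z)-g(x)-\langle\zeta,z-x\rangle}{\|z-x\|}\ge 0\}$, and $\partial g(x)$ is the limiting subdifferential: the set of $\zeta$ for which there exist $x^k\to x$ with $g(x^k)\to g(x)$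 and $\zeta^k\in\hat\partial g(x^k)$ with $\zeta^k\to\zeta$; $\partial g(x)=\emptyset$ if $g(x)=\infty$. Algorithm IRL$_1e_2$. Start with $x^0,z^0\in C$ and $\{\theta_k\}\subset(0,1]$. For $k=0,1,2,\dots$ (run without termination) set $s^{k+1}=\Phi'_+(|x^k|)$, $y^k=(1-\theta_k)x^k+\theta_kz^k$, let $z^{k+1}$ be the unique minimizer over $x\in C$ of $\langle\nabla f(y^k),x-y^k\rangle+\frac{L\theta_k}{2}\|x-z^k\|^2+\sum_{i=1}^n s^{k+1}_i|x_i|$, and set $x^{k+1}=(1-\theta_k)x^k+\theta_kz^{k+1}$. *)

theory Defs
  imports "HOL-Analysis.Analysis"
begin

definition indicator_ext :: "'a set \<Rightarrow> 'a \<Rightarrow> ereal" where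
  "indicator_ext C x = (if x \<in> C then 0 else \<infinity>)"

text \<open>
  The penalty \<open>\<phi>\<close>, mathematically a map from the nonnegative reals to themselves, is a function
  on \<open>real\<close> that is only ever evaluated at nonnegative arguments.
\<close>

definition separable_sum :: "(real \<Rightarrow> real) \<Rightarrow> real ^ 'n \<Rightarrow> real" where
  "separable_sum \<phi> y = (\<Sum>i\<in>UNIV. \<phi> (y $ i))"

definition right_deriv :: "(real \<Rightarrow> real) \<Rightarrow> real \<Rightarrow> real" where
  "right_deriv \<phi> t = Lim (at_right 0) (\<lambda>h. (\<phi> (t + h) - \<phi> t) / h)"

definition vec_right_deriv :: "(real \<Rightarrow> real) \<Rightarrow> real ^ 'n \<Rightarrow> real ^ 'n" where
  "vec_right_deriv \<phi> y = (\<chi> i. right_deriv \<phi> (y $ i))"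

definition is_penalty :: "(real \<Rightarrow> real) \<Rightarrow> bool" where
  "is_penalty \<phi> \<longleftrightarrow>
     (\<forall>t\<ge>0. \<phi> t \<ge> 0) \<and>
     continuous_on {0..} \<phi> \<and>
     concave_on {0..} \<phi> \<and>
     \<phi> 0 = 0 \<and>
     (\<forall>t>0. \<phi> differentiable (at t)) \<and>
     continuous_on {0<..} (deriv \<phi>) \<and>
     (\<exists>l::real. (deriv \<phi> \<longlongrightarrow> l) (at_right 0))"

text \<open>On \<open>real ^ 'n\<close> the absolute value \<open>\<bar>x\<bar>\<close> is the componentwise one (see \<open>abs_vec_def\<close>).\<close>

definition objective ::
  "(real ^ 'n \<Rightarrow> real) \<Rightarrow> (real ^ 'n) set \<Rightarrow> (real \<Rightarrow> real) \<Rightarrow> real ^ 'n \<Rightarrow> ereal" where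
  "objective f C \<phi> x = ereal (f x) + indicator_ext C x + ereal (separable_sum \<phi> \<bar>x\<bar>)"

definition potential ::
  "real \<Rightarrow> (real ^ 'n \<Rightarrow> real) \<Rightarrow> (real ^ 'n) set \<Rightarrow> (real \<Rightarrow> real)
     \<Rightarrow> real ^ 'n \<Rightarrow> real ^ 'n \<Rightarrow> ereal" where
  "potential L f C \<phi> x y =
     ereal (f x) + indicator_ext C x + ereal (separable_sum \<phi> \<bar>x\<bar>)
       + ereal (L / 2 * (norm (x - y))\<^sup>2)"

definition level_bounded :: "('a::metric_space \<Rightarrow> ereal) \<Rightarrow> bool" where
  "level_bounded g \<longleftrightarrow> (\<forall>\<alpha>::real. bounded {x. g x \<le> ereal \<alpha>})"

definition regular_subdiff :: "('a::real_inner \<Rightarrow> ereal) \<Rightarrow> 'a \<Rightarrow> 'a set" where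
  "regular_subdiff g x =
     {\<zeta>. g x < \<infinity> \<and>
       0 \<le> Liminf (at x) (\<lambda>w. (g w - g x - ereal (\<zeta> \<bullet> (w - x))) / ereal (norm (w - x)))}"

definition limiting_subdiff :: "('a::real_inner \<Rightarrow> ereal) \<Rightarrow> 'a \<Rightarrow> 'a set" where
  "limiting_subdiff g x =
     {\<zeta>. g x < \<infinity> \<and>
       (\<exists>X Z. X \<longlonglongrightarrow> x \<and> (\<lambda>k. g (X k)) \<longlonglongrightarrow> g x \<and>
              (\<forall>k. Z k \<in> regular_subdiff g (X k)) \<and> Z \<longlonglongrightarrow> \<zeta>)}"

definition irl_subproblem ::
  "real \<Rightarrow> real ^ 'n \<Rightarrow> real \<Rightarrow> real ^ 'n \<Rightarrow> real ^ 'n \<Rightarrow> real ^ 'n \<Rightarrow> real ^ 'n \<Rightarrow> real" where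
  "irl_subproblem L g \<theta> s y z u =
     g \<bullet> (u - y) + L * \<theta> / 2 * (norm (u - z))\<^sup>2 + (\<Sum>i\<in>UNIV. s $ i * \<bar>u $ i\<bar>)"

text \<open>
  \<open>gf\<close> is the gradient map of the smooth part. For \<open>L, \<theta> k > 0\<close> the subproblem is a continuous
  strongly convex problem over a nonempty closed convex set (the weights are nonnegative), so its
  minimizer exists and is unique; being \<^emph>\<open>a\<close> minimizer therefore determines \<open>z (Suc k)\<close>.
  The value \<open>s 0\<close> is not used.
\<close>

definition IRL1e2 ::
  "real \<Rightarrow> (real ^ 'n \<Rightarrow> real ^ 'n) \<Rightarrow> (real ^ 'n) set \<Rightarrow> (real \<Rightarrow> real) \<Rightarrow> (nat \<Rightarrow> real)
     \<Rightarrow> (nat \<Rightarrow> real ^ 'n) \<Rightarrow> (nat \<Rightarrow> real ^ 'n) \<Rightarrow> (nat \<Rightarrow> real ^ 'n) \<Rightarrow> (nat \<Rightarrow> real ^ 'n) \<Rightarrow> bool"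
where
  "IRL1e2 L gf C \<phi> \<theta> s x y z \<longleftrightarrow>
     x 0 \<in> C \<and> z 0 \<in> C \<and>
     (\<forall>k. s (Suc k) = vec_right_deriv \<phi> \<bar>x k\<bar> \<and>
          y k = (1 - \<theta> k) *\<^sub>R x k + \<theta> k *\<^sub>R z k \<and>
          is_arg_min (irl_subproblem L (gf (y k)) (\<theta> k) (s (Suc k)) (y k) (z k))
                     (\<lambda>u. u \<in> C) (z (Suc k)) \<and>
          x (Suc k) = (1 - \<theta> k) *\<^sub>R x k + \<theta> k *\<^sub>R z (Suc k))"

end

theory Submission
  imports Defs
begin

text \<open>
  Write \<open>F u = f u + \<Phi> \<bar>u\<bar>\<close> for the objective on \<open>C\<close> and \<open>D k = \<parallel>z (k+1) - x k\<parallel>\<close>.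

  One iteration decreases \<open>F\<close> up to a quadratic error (\<open>irl_step_descent\<close>). Four inequalities are
  added up: the quadratic upper bound of \<open>f\<close> at \<open>y k\<close> coming from the Lipschitz gradient; the lower
  bound \<open>f (y k) + \<nabla>f (y k) \<bullet> (x k - y k) \<le> f (x k)\<close> from convexity; the linearization
  \<open>\<Phi> \<bar>w\<bar> \<le> \<Phi> \<bar>x k\<bar> + s \<bullet> (\<bar>w\<bar> - \<bar>x k\<bar>)\<close>, which holds because \<open>\<phi>\<close> is concave and whose right-hand
  side is convex in \<open>w\<close> because \<open>s \<ge> 0\<close>; and the optimality of \<open>z (k+1)\<close> in a strongly convex
  subproblem, tested at \<open>x k\<close>. The outcome is
  \<open>F (x (k+1)) + L/2 \<parallel>x (k+1) - x k\<parallel>\<^sup>2 \<le> F (x k) + L/2 (\<theta> k)\<^sup>2 \<parallel>x k - z k\<parallel>\<^sup>2\<close>.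

  Both distances are multiples of some \<open>D\<close>: \<open>x (k+1) - x k = \<theta> k (z (k+1) - x k)\<close> and
  \<open>x (k+1) - z (k+1) = (1 - \<theta> k) (x k - z (k+1))\<close>. Hence the potential drops in each step by at
  least \<open>L/2 ((\<theta> k)\<^sup>2 - (\<theta> (k+1))\<^sup>2 (1 - \<theta> k)\<^sup>2) (D k)\<^sup>2\<close>, and the condition on \<open>\<theta>\<close> bounds the
  coefficient below by a positive constant. Monotonicity and level-boundedness keep the \<open>x k\<close> in a
  bounded set, where \<open>F \<ge> f\<close> is bounded below, so the potential converges; its decrements therefore
  tend to \<open>0\<close>, and so does \<open>D\<close>. The remaining differences are controlled by \<open>D\<close>, and \<open>z\<close> is
  bounded because \<open>x\<close> is.

  Stationarity is read off from a first-order expansion. Passing to the limit in the optimality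
  inequality of the subproblem (\<open>irl_minimizer_inequality\<close>), with \<open>\<phi>'\<^sub>+\<close> continuous on \<open>[0,\<infinity>)\<close>,
  shows that an accumulation point \<open>z\<^sup>*\<close> minimizes the linearized problem
  \<open>\<nabla>f z\<^sup>* \<bullet> u + (\<Sum>i. \<phi>'\<^sub>+ \<bar>z\<^sup>* i\<bar> * \<bar>u i\<bar>)\<close> over \<open>C\<close>. To first order at \<open>z\<^sup>*\<close>, \<open>\<Phi> \<bar>u\<bar>\<close> changes
  exactly like this weighted \<open>\<ell>\<^sub>1\<close> norm: a one-sided derivative of \<open>\<phi>\<close> at \<open>0\<close> suffices since \<open>\<bar>u i\<bar>\<close>
  never becomes negative. So \<open>F u \<ge> F z\<^sup>* - o \<parallel>u - z\<^sup>*\<parallel>\<close> on \<open>C\<close>, which says that \<open>0\<close> is already a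
  regular subgradient at \<open>z\<^sup>*\<close> (\<open>linearized_minimizer_stationary\<close>).
\<close>

section \<open>Convex and smooth functions\<close>

text \<open>
  Secant slopes \<open>(f (c + t (w - c)) - f c) / t\<close> with \<open>0 < t \<le> 1\<close> are at most \<open>f w - f c\<close>; let \<open>t\<close>
  tend to \<open>0\<close>. The derivative is taken relative to \<open>S\<close>, so that \<open>c\<close> may lie on the boundary: the
  penalty needs this at \<open>0\<close>.
\<close>

lemma convex_on_above_derivative:
  fixes f :: "'a::real_normed_vector \<Rightarrow> real"
  assumes cvx: "convex_on S f" and der: "(f has_derivative f') (at c within S)"
    and c: "c \<in> S" and w: "w \<in> S"
  shows "f c + f' (w - c) \<le> f w"
proof -
  let ?g = "\<lambda>t::real. c + t *\<^sub>R (w - c)"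
  have "convex S"
    using cvx by (simp add: convex_on_def)
  have g_alt: "?g t = (1 - t) *\<^sub>R c + t *\<^sub>R w" for t
    by (simp add: algebra_simps)
  have g_in: "?g ` {0..1} \<subseteq> S"
    using \<open>convex S\<close> c w unfolding g_alt by (auto intro!: convexD_alt)
  have "(?g has_derivative (\<lambda>t. t *\<^sub>R (w - c))) (at 0 within {0..1})"
    by (auto intro!: derivative_eq_intros)
  then have "((\<lambda>t. f (?g t)) has_derivative (\<lambda>t. f' (t *\<^sub>R (w - c)))) (at 0 within {0..1})"
    using has_derivative_in_compose[of ?g _ 0 "{0..1}" f f']
      has_derivative_subset[OF der g_in] by simp
  moreover have "(\<lambda>t. f' (t *\<^sub>R (w - c))) = (*) (f' (w - c))"
    using linear_scale[OF has_derivative_linear[OF der]] by auto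
  ultimately have "((\<lambda>t. f (?g t)) has_real_derivative f' (w - c)) (at 0 within {0..1})"
    by (simp add: has_field_derivative_def)
  then have lim: "((\<lambda>t. (f (?g t) - f c) / t) \<longlongrightarrow> f' (w - c)) (at 0 within {0..1})"
    by (simp add: has_field_derivative_iff)
  have "(f (?g t) - f c) / t \<le> f w - f c" if "t \<in> {0..1}" "t \<noteq> 0" for t
  proof -
    have "f (?g t) \<le> (1 - t) * f c + t * f w"
      unfolding g_alt using convex_onD[OF cvx] c w that by auto
    then show ?thesis
      using that by (simp add: field_simps)
  qed
  then have ev: "eventually (\<lambda>t. (f (?g t) - f c) / t \<le> f w - f c) (at 0 within {0..1})"
    by (auto simp: eventually_at_filter)
  have "at (0::real) within {0..1} \<noteq> bot"
    by (simp add: at_within_Icc_at_right)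
  then have "f' (w - c) \<le> f w - f c"
    by (rule tendsto_upperbound[OF lim ev])
  then show ?thesis
    by simp
qed

text \<open>
  Along the segment from \<open>u\<close> to \<open>v\<close>, the difference between \<open>f\<close> and the claimed quadratic bound has
  nonpositive derivative, by Cauchy--Schwarz and the Lipschitz condition.
\<close>

lemma lipschitz_gradient_quadratic_bound:
  fixes f :: "'a::real_inner \<Rightarrow> real"
  assumes grad: "\<And>u. GDERIV f u :> gf u" and lip: "L-lipschitz_on UNIV gf"
  shows "f v \<le> f u + gf u \<bullet> (v - u) + L / 2 * (norm (v - u))\<^sup>2"
proof -
  let ?d = "v - u"
  let ?\<psi> = "\<lambda>t::real. f (u + t *\<^sub>R ?d) - t * (gf u \<bullet> ?d) - L / 2 * t\<^sup>2 * (norm ?d)\<^sup>2"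
  have "\<exists>m. (?\<psi> has_real_derivative m) (at t) \<and> m \<le> 0" if t: "0 \<le> t" "t \<le> 1" for t
  proof -
    let ?m = "gf (u + t *\<^sub>R ?d) \<bullet> ?d - gf u \<bullet> ?d - L * t * (norm ?d)\<^sup>2"
    have f: "(f has_derivative (\<lambda>h. h \<bullet> gf (u + t *\<^sub>R ?d))) (at (u + t *\<^sub>R ?d))"
      using grad by (simp add: gderiv_def)
    have "((\<lambda>t. f (u + t *\<^sub>R ?d)) has_derivative
        (\<lambda>h. (h *\<^sub>R ?d) \<bullet> gf (u + t *\<^sub>R ?d))) (at t)"
      by (rule has_derivative_compose[where f = "\<lambda>t. u + t *\<^sub>R ?d", OF _ f])
        (auto intro!: derivative_eq_intros)
    then have "((\<lambda>t. f (u + t *\<^sub>R ?d)) has_real_derivative (gf (u + t *\<^sub>R ?d) \<bullet> ?d)) (at t)"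
      by (simp add: has_field_derivative_def inner_commute mult_commute_abs)
    then have "(?\<psi> has_real_derivative ?m) (at t)"
      by (auto intro!: derivative_eq_intros)
    moreover have "?m \<le> 0"
    proof -
      have "(gf (u + t *\<^sub>R ?d) - gf u) \<bullet> ?d \<le> norm (gf (u + t *\<^sub>R ?d) - gf u) * norm ?d"
        by (rule norm_cauchy_schwarz)
      also have "\<dots> \<le> (L * norm (t *\<^sub>R ?d)) * norm ?d"
        using lipschitz_onD[OF lip, of "u + t *\<^sub>R ?d" u]
        by (intro mult_right_mono) (auto simp: dist_norm)
      finally show ?thesis
        using t by (simp add: inner_diff_left power2_eq_square)
    qed
    ultimately show ?thesis
      by blast
  qed
  then have "?\<psi> 1 \<le> ?\<psi> 0"
    by (rule DERIV_nonpos_imp_nonincreasing[of 0 1 ?\<psi>, OF zero_le_one])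
  then show ?thesis
    by simp
qed

text \<open>
  This is the variational inequality of a proximal step. Comparing \<open>v\<close> with the point
  \<open>(1 - t) v + t u\<close> and dividing by \<open>t\<close> leaves an error of order \<open>t\<close>, which vanishes as \<open>t\<close> tends
  to \<open>0\<close>. In contrast to minimality itself, the proximal term enters only through \<open>v - a\<close>, so it
  disappears in the limit when consecutive iterates approach each other.
\<close>

lemma proximal_minimizer_inequality:
  fixes h :: "'a::real_inner \<Rightarrow> real"
  assumes cvx: "convex_on C h" and v: "v \<in> C" and u: "u \<in> C"
    and minimal: "\<And>w. w \<in> C \<Longrightarrow> h v + \<mu> / 2 * (norm (v - a))\<^sup>2 \<le> h w + \<mu> / 2 * (norm (w - a))\<^sup>2"
  shows "h v \<le> h u + \<mu> * ((v - a) \<bullet> (u - v))"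
proof -
  let ?R = "\<lambda>t::real. h u + \<mu> * ((v - a) \<bullet> (u - v)) + t * (\<mu> / 2 * (norm (u - v))\<^sup>2)"
  have "h v \<le> ?R t" if t: "t \<in> {0<..1}" for t
  proof -
    let ?w = "(1 - t) *\<^sub>R v + t *\<^sub>R u"
    have "?w \<in> C"
      using cvx v u t by (auto simp: convex_on_def intro!: convexD_alt)
    have "?w - a = (v - a) + t *\<^sub>R (u - v)"
      by (simp add: algebra_simps)
    then have norm_w: "(norm (?w - a))\<^sup>2
        = (norm (v - a))\<^sup>2 + 2 * t * ((v - a) \<bullet> (u - v)) + t\<^sup>2 * (norm (u - v))\<^sup>2"
      by (simp only: power2_norm_eq_inner)
        (simp add: inner_add_left inner_add_right inner_commute power2_eq_square)
    have "h v + \<mu> / 2 * (norm (v - a))\<^sup>2 \<le> h ?w + \<mu> / 2 * (norm (?w - a))\<^sup>2"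
      using minimal \<open>?w \<in> C\<close> by blast
    moreover have "h ?w \<le> (1 - t) * h v + t * h u"
      using convex_onD[OF cvx] v u t by auto
    ultimately have "t * h v \<le> t * ?R t"
      unfolding norm_w by (simp add: algebra_simps power2_eq_square)
    then show ?thesis
      using t by simp
  qed
  then have "eventually (\<lambda>t. h v \<le> ?R t) (at_right 0)"
    unfolding eventually_at_right_field by (auto intro!: exI[of _ 1])
  moreover have "(?R \<longlongrightarrow> ?R 0) (at_right 0)"
    by (intro tendsto_intros)
  ultimately have "h v \<le> ?R 0"
    by (intro tendsto_lowerbound[where F = "at_right 0"]) auto
  then show ?thesis
    by simp
qed

section \<open>The penalty and its right derivative\<close>

lemma right_deriv_eqI:
  assumes "(\<phi> has_real_derivative d) (at t within {t..})"
  shows "right_deriv \<phi> t = d"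
proof -
  have "((\<lambda>w. (\<phi> w - \<phi> t) / (w - t)) \<longlongrightarrow> d) (at_right t)"
    using assms by (simp add: has_field_derivative_iff at_within_Ici_at_right)
  then have "((\<lambda>h. (\<phi> (t + h) - \<phi> t) / h) \<longlongrightarrow> d) (at_right 0)"
    by (subst (asm) at_right_to_0) (simp add: filterlim_filtermap add.commute)
  then show ?thesis
    unfolding right_deriv_def by (intro tendsto_Lim) auto
qed

text \<open>
  L'Hopital's rule turns the limit of \<open>deriv \<phi>\<close> into the limit of the difference quotients
  \<open>\<phi> h / h\<close>. Thus the limiting slope and the right derivative at \<open>0\<close> agree, which makes the right
  derivative continuous up to \<open>0\<close>.
\<close>

lemma penalty_has_derivative_at_0:
  assumes pen: "is_penalty \<phi>" and l: "(deriv \<phi> \<longlongrightarrow> l) (at_right 0)"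
  shows "(\<phi> has_real_derivative l) (at 0 within {0..})"
proof -
  have "(\<phi> \<longlongrightarrow> \<phi> 0) (at 0 within {0..})"
    using pen unfolding is_penalty_def continuous_on_def by (meson atLeast_iff order_refl)
  then have "(\<phi> \<longlongrightarrow> 0) (at_right 0)"
    using pen by (simp add: is_penalty_def at_within_Ici_at_right)
  moreover have "eventually (\<lambda>h. (\<phi> has_real_derivative deriv \<phi> h) (at h)) (at_right 0)"
    using pen unfolding eventually_at_right_field
    by (auto simp: is_penalty_def DERIV_deriv_iff_real_differentiable intro!: exI[of _ 1])
  moreover have "eventually (\<lambda>h::real. h \<noteq> 0) (at_right 0)"
    by (simp add: eventually_at_filter)
  ultimately have "((\<lambda>h. \<phi> h / h) \<longlongrightarrow> l) (at_right 0)"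
    using l lhopital_right_0[of \<phi> "\<lambda>h. h" "\<lambda>_. 1" "deriv \<phi>" "nhds l"] by simp
  then show ?thesis
    using pen by (simp add: has_field_derivative_iff at_within_Ici_at_right is_penalty_def)
qed

lemma penalty_has_derivative:
  assumes pen: "is_penalty \<phi>" and t: "0 \<le> t"
  shows "(\<phi> has_real_derivative right_deriv \<phi> t) (at t within {0..})"
proof -
  have "\<exists>d. (\<phi> has_real_derivative d) (at t within {0..})"
  proof (cases "t = 0")
    case False
    then have "\<phi> differentiable (at t)"
      using pen t by (auto simp: is_penalty_def)
    then show ?thesis
      using real_differentiable_def has_field_derivative_at_within by blast
  next
    case True
    then show ?thesis
      using penalty_has_derivative_at_0[OF pen] pen by (auto simp: is_penalty_def)
  qed
  then obtain d where d: "(\<phi> has_real_derivative d) (at t within {0..})" ..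
  then have "(\<phi> has_real_derivative d) (at t within {t..})"
    by (rule has_field_derivative_subset) (use t in auto)
  then show ?thesis
    using d by (simp add: right_deriv_eqI)
qed

lemma right_deriv_eq_deriv:
  assumes "is_penalty \<phi>" and "0 < t"
  shows "right_deriv \<phi> t = deriv \<phi> t"
proof (rule right_deriv_eqI)
  have "\<phi> differentiable (at t)"
    using assms by (simp add: is_penalty_def)
  then show "(\<phi> has_real_derivative deriv \<phi> t) (at t within {t..})"
    by (simp add: DERIV_deriv_iff_real_differentiable has_field_derivative_at_within)
qed

lemma penalty_below_tangent:
  assumes pen: "is_penalty \<phi>" and a: "0 \<le> a" and b: "0 \<le> b"
  shows "\<phi> b \<le> \<phi> a + right_deriv \<phi> a * (b - a)"
proof -
  have "((\<lambda>t. - \<phi> t) has_derivative (\<lambda>h. - (right_deriv \<phi> a * h))) (at a within {0..})"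
    using penalty_has_derivative[OF pen a]
    unfolding has_field_derivative_def by (rule has_derivative_minus)
  moreover have "convex_on {0..} (\<lambda>t. - \<phi> t)"
    using pen by (simp add: is_penalty_def concave_on_def)
  ultimately show ?thesis
    using convex_on_above_derivative[of "{0..}" "\<lambda>t. - \<phi> t" "\<lambda>h. - (right_deriv \<phi> a * h)" a b]
      a b by auto
qed

text \<open>
  A negative slope \<open>s\<close> at \<open>a\<close> would force \<open>\<phi>\<close>, which lies below its tangent, to become negative:
  at \<open>a - (\<phi> a + 1) / s \<ge> a\<close> the tangent has the value \<open>-1\<close>.
\<close>

lemma right_deriv_penalty_nonneg:
  assumes pen: "is_penalty \<phi>" and a: "0 \<le> a"
  shows "0 \<le> right_deriv \<phi> a"
proof (rule ccontr)
  let ?s = "right_deriv \<phi> a" and ?b = "a - (\<phi> a + 1) / right_deriv \<phi> a"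
  assume "\<not> 0 \<le> ?s"
  then have s: "?s < 0"
    by simp
  have nonneg: "0 \<le> \<phi> t" if "0 \<le> t" for t
    using pen that by (simp add: is_penalty_def)
  have "(\<phi> a + 1) / ?s \<le> 0"
    using nonneg[OF a] s by (simp add: divide_nonneg_neg)
  then have b: "0 \<le> ?b"
    using a by simp
  have "\<phi> ?b \<le> -1"
    using penalty_below_tangent[OF pen a b] s by simp
  with nonneg[OF b] show False
    by simp
qed

lemma continuous_on_right_deriv_penalty:
  assumes pen: "is_penalty \<phi>"
  shows "continuous_on {0..} (right_deriv \<phi>)"
  unfolding continuous_on_def
proof
  fix t :: real
  assume t: "t \<in> {0..}"
  show "(right_deriv \<phi> \<longlongrightarrow> right_deriv \<phi> t) (at t within {0..})"
  proof (cases "t = 0")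
    case True
    obtain l where l: "(deriv \<phi> \<longlongrightarrow> l) (at_right 0)"
      using pen by (auto simp: is_penalty_def)
    have "\<forall>\<^sub>F w in at_right 0. deriv \<phi> w = right_deriv \<phi> w"
      by (auto simp: eventually_at_filter right_deriv_eq_deriv[OF pen])
    with l have "(right_deriv \<phi> \<longlongrightarrow> l) (at_right 0)"
      by (rule Lim_transform_eventually)
    then show ?thesis
      using right_deriv_eqI[OF penalty_has_derivative_at_0[OF pen l]] True
      by (simp add: at_within_Ici_at_right)
  next
    case False
    then have "continuous (at t) (deriv \<phi>)"
      using pen t by (auto simp: is_penalty_def continuous_on_eq_continuous_at)
    then have "(deriv \<phi> \<longlongrightarrow> right_deriv \<phi> t) (at t)"
      using t False by (simp add: isCont_def right_deriv_eq_deriv[OF pen])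
    moreover have "\<forall>\<^sub>F w in at t. deriv \<phi> w = right_deriv \<phi> w"
      using eventually_at_in_open'[of "{0<..}" t] t False
      by (auto simp: right_deriv_eq_deriv[OF pen] elim!: eventually_mono)
    ultimately have "(right_deriv \<phi> \<longlongrightarrow> right_deriv \<phi> t) (at t)"
      by (rule Lim_transform_eventually)
    then show ?thesis
      by (rule tendsto_within_subset) simp
  qed
qed

section \<open>One step of the algorithm\<close>

lemma separable_sum_below_tangent:
  fixes v w :: "real ^ 'n"
  assumes pen: "is_penalty \<phi>"
  shows "separable_sum \<phi> \<bar>w\<bar>
    \<le> separable_sum \<phi> \<bar>v\<bar> + (\<Sum>i\<in>UNIV. vec_right_deriv \<phi> \<bar>v\<bar> $ i * (\<bar>w $ i\<bar> - \<bar>v $ i\<bar>))"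
  using penalty_below_tangent[OF pen, of "\<bar>v $ _\<bar>" "\<bar>w $ _\<bar>"]
  by (auto simp: separable_sum_def vec_right_deriv_def abs_vec_def simp flip: sum.distrib
      intro!: sum_mono)

lemma convex_on_weighted_l1:
  fixes s :: "real ^ 'n"
  assumes "convex S" and "\<And>i. 0 \<le> s $ i"
  shows "convex_on S (\<lambda>u. \<Sum>i\<in>UNIV. s $ i * \<bar>u $ i\<bar>)"
proof (rule convex_onI)
  fix t :: real and u v :: "real ^ 'n"
  assume t: "0 < t" "t < 1"
  have "\<bar>(1 - t) * (u $ i) + t * (v $ i)\<bar> \<le> (1 - t) * \<bar>u $ i\<bar> + t * \<bar>v $ i\<bar>" for i
    using abs_triangle_ineq[of "(1 - t) * (u $ i)" "t * (v $ i)"] t by (simp add: abs_mult)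
  then have "s $ i * \<bar>(1 - t) * (u $ i) + t * (v $ i)\<bar>
      \<le> (1 - t) * (s $ i * \<bar>u $ i\<bar>) + t * (s $ i * \<bar>v $ i\<bar>)" for i
    using mult_left_mono[OF _ assms(2)] by (fastforce simp: algebra_simps)
  then show "(\<Sum>i\<in>UNIV. s $ i * \<bar>((1 - t) *\<^sub>R u + t *\<^sub>R v) $ i\<bar>)
      \<le> (1 - t) * (\<Sum>i\<in>UNIV. s $ i * \<bar>u $ i\<bar>) + t * (\<Sum>i\<in>UNIV. s $ i * \<bar>v $ i\<bar>)"
    by (auto simp: sum_distrib_left simp flip: sum.distrib intro!: sum_mono)
qed (rule assms(1))

lemma irl_minimizer_inequality:
  fixes s :: "real ^ 'n"
  assumes "convex C" and s: "\<And>i. 0 \<le> s $ i"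
    and arg_min: "is_arg_min (irl_subproblem L g \<theta> s y a) (\<lambda>u. u \<in> C) v" and u: "u \<in> C"
  shows "g \<bullet> v + (\<Sum>i\<in>UNIV. s $ i * \<bar>v $ i\<bar>)
    \<le> g \<bullet> u + (\<Sum>i\<in>UNIV. s $ i * \<bar>u $ i\<bar>) + L * \<theta> * ((v - a) \<bullet> (u - v))"
proof (rule proximal_minimizer_inequality[where C = C
      and h = "\<lambda>u. g \<bullet> u + (\<Sum>i\<in>UNIV. s $ i * \<bar>u $ i\<bar>)"])
  have "convex_on C (\<lambda>u. g \<bullet> u)"
    using \<open>convex C\<close> by (auto intro!: convex_onI simp: inner_add_right)
  then show "convex_on C (\<lambda>u. g \<bullet> u + (\<Sum>i\<in>UNIV. s $ i * \<bar>u $ i\<bar>))"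
    by (rule convex_on_add[OF _ convex_on_weighted_l1[OF \<open>convex C\<close> s]])
next
  fix w assume "w \<in> C"
  then have "irl_subproblem L g \<theta> s y a v \<le> irl_subproblem L g \<theta> s y a w"
    using arg_min by (simp add: is_arg_min_linorder)
  then show "g \<bullet> v + (\<Sum>i\<in>UNIV. s $ i * \<bar>v $ i\<bar>) + L * \<theta> / 2 * (norm (v - a))\<^sup>2
      \<le> g \<bullet> w + (\<Sum>i\<in>UNIV. s $ i * \<bar>w $ i\<bar>) + L * \<theta> / 2 * (norm (w - a))\<^sup>2"
    by (simp add: irl_subproblem_def inner_diff_right)
qed (use arg_min u in \<open>simp_all add: is_arg_min_def\<close>)

text \<open>
  The relation \<open>w - y = \<theta> (v - z)\<close> makes the curvature error of \<open>f\<close> equal to the proximal term of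
  the subproblem scaled by \<open>\<theta>\<close>, so the two cancel in the optimality inequality for \<open>v\<close> tested at \<open>x\<close>.
  The error that remains is the distance that the previous step has left between its two outputs
  \<open>x\<close> and \<open>z\<close>, which is what makes the estimate telescope.
\<close>

lemma irl_step_descent:
  fixes f :: "real ^ 'n \<Rightarrow> real" and \<phi> :: "real \<Rightarrow> real"
  defines "F \<equiv> \<lambda>u. f u + separable_sum \<phi> \<bar>u\<bar>"
  assumes f_convex: "convex_on UNIV f" and grad: "\<And>u. GDERIV f u :> gf u"
    and lip: "L-lipschitz_on UNIV gf" and C: "convex C" and pen: "is_penalty \<phi>"
    and \<theta>: "0 < \<theta>" "\<theta> \<le> 1" and x: "x \<in> C"
    and y: "y = (1 - \<theta>) *\<^sub>R x + \<theta> *\<^sub>R z"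
    and arg_min: "is_arg_min (irl_subproblem L (gf y) \<theta> (vec_right_deriv \<phi> \<bar>x\<bar>) y z)
      (\<lambda>u. u \<in> C) v"
    and w: "w = (1 - \<theta>) *\<^sub>R x + \<theta> *\<^sub>R v"
  shows "F w + L / 2 * (norm (w - x))\<^sup>2 \<le> F x + L / 2 * \<theta>\<^sup>2 * (norm (x - z))\<^sup>2"
proof -
  let ?s = "vec_right_deriv \<phi> \<bar>x\<bar>"
  let ?p = "\<lambda>u :: real ^ 'n. \<Sum>i\<in>UNIV. ?s $ i * \<bar>u $ i\<bar>"
  have s: "0 \<le> ?s $ i" for i
    using right_deriv_penalty_nonneg[OF pen] by (simp add: vec_right_deriv_def abs_vec_def)
  have wy: "w - y = \<theta> *\<^sub>R (v - z)" and wx: "w - x = \<theta> *\<^sub>R (v - x)"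
    by (simp_all add: w y algebra_simps)
  have smooth: "f w \<le> f y + gf y \<bullet> (w - y) + L / 2 * \<theta>\<^sup>2 * (norm (v - z))\<^sup>2"
    using lipschitz_gradient_quadratic_bound[OF grad lip, of w y] \<theta>
    by (simp add: wy power_mult_distrib)
  have tangent: "f y + gf y \<bullet> (x - y) \<le> f x"
    using convex_on_above_derivative[OF f_convex, of "\<lambda>h. h \<bullet> gf y" y x] grad[of y]
    by (simp add: gderiv_def inner_commute)
  have "separable_sum \<phi> \<bar>w\<bar> \<le> separable_sum \<phi> \<bar>x\<bar> + (?p w - ?p x)"
    using separable_sum_below_tangent[OF pen, of w x]
    by (simp add: right_diff_distrib sum_subtractf)
  moreover have "?p w \<le> (1 - \<theta>) * ?p x + \<theta> * ?p v"
    unfolding w using convex_onD[OF convex_on_weighted_l1[OF convex_UNIV s], of \<theta> x v] \<theta> by simp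
  ultimately have penalty: "separable_sum \<phi> \<bar>w\<bar> \<le> separable_sum \<phi> \<bar>x\<bar> + \<theta> * (?p v - ?p x)"
    by (simp add: algebra_simps)
  have "gf y \<bullet> v + ?p v \<le> gf y \<bullet> x + ?p x + L * \<theta> * ((v - z) \<bullet> (x - v))"
    by (rule irl_minimizer_inequality[OF C s arg_min x])
  then have "\<theta> * (gf y \<bullet> v + ?p v) \<le> \<theta> * (gf y \<bullet> x + ?p x + L * \<theta> * ((v - z) \<bullet> (x - v)))"
    using \<theta> by (simp add: mult_left_mono)
  then have opt: "\<theta> * (gf y \<bullet> v - gf y \<bullet> x) + \<theta> * (?p v - ?p x)
      \<le> L / 2 * \<theta>\<^sup>2 * (2 * ((v - z) \<bullet> (x - v)))"
    by (simp add: algebra_simps power2_eq_square)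
  \<comment> \<open>The term \<open>- \<parallel>v - z\<parallel>\<^sup>2\<close> cancels the curvature term of \<open>smooth\<close>; \<open>- \<parallel>x - v\<parallel>\<^sup>2\<close> is the gain.\<close>
  have "2 * ((v - z) \<bullet> (x - v)) = (norm (x - z))\<^sup>2 - (norm (x - v))\<^sup>2 - (norm (v - z))\<^sup>2"
    by (simp add: power2_norm_eq_inner inner_diff_left inner_diff_right inner_commute)
  then have three_point: "L / 2 * \<theta>\<^sup>2 * (2 * ((v - z) \<bullet> (x - v)))
      = L / 2 * \<theta>\<^sup>2 * (norm (x - z))\<^sup>2 - L / 2 * \<theta>\<^sup>2 * (norm (x - v))\<^sup>2
        - L / 2 * \<theta>\<^sup>2 * (norm (v - z))\<^sup>2"
    by (simp only: right_diff_distrib)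
  have linear: "gf y \<bullet> (w - y) = gf y \<bullet> (x - y) + \<theta> * (gf y \<bullet> v - gf y \<bullet> x)"
    by (simp add: w algebra_simps)
  have move: "L / 2 * (norm (w - x))\<^sup>2 = L / 2 * \<theta>\<^sup>2 * (norm (x - v))\<^sup>2"
    using \<theta> by (simp add: wx power_mult_distrib norm_minus_commute)
  show ?thesis
    using smooth tangent penalty opt three_point linear move unfolding F_def by linarith
qed

section \<open>Stationarity of minimizers of the linearized problem\<close>

text \<open>
  Although \<open>t \<mapsto> \<phi> \<bar>t\<bar>\<close> may have a kink at \<open>0\<close>, it is approximated to first order by
  \<open>t \<mapsto> \<phi> \<bar>a\<bar> + \<phi>'\<^sub>+ \<bar>a\<bar> (\<bar>t\<bar> - \<bar>a\<bar>)\<close>: expand \<open>\<phi>\<close> on \<open>[0,\<infinity>)\<close> at \<open>\<bar>a\<bar>\<close> and use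
  \<open>\<bar>\<bar>t\<bar> - \<bar>a\<bar>\<bar> \<le> \<bar>t - a\<bar>\<close>. Only the lower bound is stated, since subgradients are about minorants.
\<close>

lemma penalty_first_order_expansion:
  assumes pen: "is_penalty \<phi>" and "0 < e"
  shows "\<forall>\<^sub>F t in nhds (a::real).
    \<phi> (\<bar>a\<bar>) + right_deriv \<phi> (\<bar>a\<bar>) * (\<bar>t\<bar> - \<bar>a\<bar>) - e * \<bar>t - a\<bar> \<le> \<phi> (\<bar>t\<bar>)"
proof -
  let ?b = "\<bar>a\<bar>"
  have "(\<phi> has_derivative (*) (right_deriv \<phi> ?b)) (at ?b within {0..})"
    by (rule penalty_has_derivative[OF pen abs_ge_zero, unfolded has_field_derivative_def])
  then have "\<exists>d>0. \<forall>r\<in>{0..}. norm (r - ?b) < d \<longrightarrow>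
      norm (\<phi> r - \<phi> ?b - right_deriv \<phi> ?b * (r - ?b)) \<le> e * norm (r - ?b)"
    using \<open>0 < e\<close> unfolding has_derivative_within_alt by (elim conjE allE[of _ e] impE)
  then obtain d where d: "0 < d" and expand:
    "\<And>r. r \<in> {0..} \<Longrightarrow> norm (r - ?b) < d \<Longrightarrow>
      norm (\<phi> r - \<phi> ?b - right_deriv \<phi> ?b * (r - ?b)) \<le> e * norm (r - ?b)"
    by blast
  show ?thesis
    unfolding eventually_nhds_metric
  proof (intro exI[of _ d] conjI d allI impI)
    fix t :: real
    assume t: "dist t a < d"
    have close: "\<bar>\<bar>t\<bar> - \<bar>a\<bar>\<bar> \<le> \<bar>t - a\<bar>"
      by (rule abs_triangle_ineq3)
    then have "norm (\<phi> (\<bar>t\<bar>) - \<phi> ?b - right_deriv \<phi> ?b * (\<bar>t\<bar> - ?b)) \<le> e * \<bar>\<bar>t\<bar> - ?b\<bar>"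
      using expand[of "\<bar>t\<bar>"] t by (simp add: dist_real_def)
    moreover have "e * \<bar>\<bar>t\<bar> - ?b\<bar> \<le> e * \<bar>t - a\<bar>"
      using close \<open>0 < e\<close> by simp
    ultimately show "\<phi> (\<bar>a\<bar>) + right_deriv \<phi> (\<bar>a\<bar>) * (\<bar>t\<bar> - \<bar>a\<bar>) - e * \<bar>t - a\<bar> \<le> \<phi> (\<bar>t\<bar>)"
      unfolding real_norm_def by linarith
  qed
qed

lemma zero_regular_subgradient_of_minorant:
  fixes G :: "'a::real_inner \<Rightarrow> real"
  assumes "v \<in> C" and finite: "\<And>u. u \<in> C \<Longrightarrow> g u = ereal (G u)"
    and infinite: "\<And>u. u \<notin> C \<Longrightarrow> g u = \<infinity>"
    and minorant: "\<And>e. 0 < e \<Longrightarrow> \<forall>\<^sub>F u in nhds v. u \<in> C \<longrightarrow> G v - e * norm (u - v) \<le> G u"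
  shows "0 \<in> regular_subdiff g v"
proof -
  have "0 \<le> Liminf (at v) (\<lambda>u. (g u - g v - ereal (0 \<bullet> (u - v))) / ereal (norm (u - v)))"
    unfolding le_Liminf_iff
  proof (intro allI impI)
    fix b :: ereal
    assume "b < 0"
    then obtain e where e: "0 < e" "b < ereal (- e)"
    proof (cases b)
      case (real r)
      then show thesis
        using \<open>b < 0\<close> that[of "- r / 2"] by (simp add: zero_ereal_def)
    next
      case MInf
      then show thesis
        using that[of 1] by simp
    qed (use \<open>b < 0\<close> in simp)
    have "\<forall>\<^sub>F u in at v. u \<in> C \<longrightarrow> G v - e * norm (u - v) \<le> G u"
      using minorant[OF e(1)] by (auto simp: eventually_at_filter elim: eventually_mono)
    moreover have "\<forall>\<^sub>F u in at v. u \<noteq> v"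
      by (simp add: eventually_at_filter)
    ultimately show "\<forall>\<^sub>F u in at v.
        b < (g u - g v - ereal (0 \<bullet> (u - v))) / ereal (norm (u - v))"
    proof eventually_elim
      case (elim u)
      show ?case
      proof (cases "u \<in> C")
        case True
        have "- e \<le> (G u - G v) / norm (u - v)"
          using elim True by (simp add: field_simps)
        then have "ereal (- e) \<le> (g u - g v - ereal (0 \<bullet> (u - v))) / ereal (norm (u - v))"
          using finite True \<open>v \<in> C\<close> elim by simp
        then show ?thesis
          using e(2) by (rule less_le_trans[rotated])
      next
        case False
        then show ?thesis
          using infinite finite \<open>v \<in> C\<close> elim e(2) by auto
      qed
    qed
  qed
  then show ?thesis
    using finite[OF \<open>v \<in> C\<close>] by (simp add: regular_subdiff_def)
qed

lemma regular_subdiff_subset_limiting_subdiff: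
  "regular_subdiff g v \<subseteq> limiting_subdiff g v"
proof
  fix \<zeta> assume "\<zeta> \<in> regular_subdiff g v"
  then show "\<zeta> \<in> limiting_subdiff g v"
    unfolding limiting_subdiff_def
    by (intro CollectI conjI exI[of _ "\<lambda>_. v"] exI[of _ "\<lambda>_. \<zeta>"])
      (simp_all add: regular_subdiff_def)
qed

text \<open>
  The first-order expansion bounds \<open>\<Phi> \<bar>u\<bar>\<close> from below by the weighted \<open>\<ell>\<^sub>1\<close> norm up to
  \<open>e \<parallel>u - v\<parallel>\<close>, the tolerance \<open>e\<close> being split evenly among the coordinates. Convexity of \<open>f\<close> gives the
  linear lower bound, and the sum of the two is minimal at \<open>v\<close>.
\<close>

lemma linearized_minimizer_stationary:
  fixes f :: "real ^ 'n \<Rightarrow> real"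
  assumes f_convex: "convex_on UNIV f" and grad: "GDERIV f v :> g"
    and pen: "is_penalty \<phi>" and v: "v \<in> C"
    and minimal: "\<And>u. u \<in> C \<Longrightarrow>
      g \<bullet> v + (\<Sum>i\<in>UNIV. vec_right_deriv \<phi> (\<bar>v\<bar>) $ i * \<bar>v $ i\<bar>)
        \<le> g \<bullet> u + (\<Sum>i\<in>UNIV. vec_right_deriv \<phi> (\<bar>v\<bar>) $ i * \<bar>u $ i\<bar>)"
  shows "0 \<in> regular_subdiff (objective f C \<phi>) v"
proof (rule zero_regular_subgradient_of_minorant[OF v,
      where G = "\<lambda>u. f u + separable_sum \<phi> (\<bar>u\<bar>)"])
  fix e :: real assume "0 < e"
  let ?e = "e / CARD('n)"
  let ?s = "vec_right_deriv \<phi> (\<bar>v\<bar>)"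
  have "\<forall>\<^sub>F u in nhds v. \<phi> (\<bar>v $ i\<bar>) + ?s $ i * (\<bar>u $ i\<bar> - \<bar>v $ i\<bar>) - ?e * \<bar>u $ i - v $ i\<bar>
      \<le> \<phi> (\<bar>u $ i\<bar>)" for i
  proof -
    have "filterlim (\<lambda>u. u $ i) (nhds (v $ i)) (nhds v)"
      by (rule tendsto_vec_nth[OF filterlim_ident])
    moreover have "\<forall>\<^sub>F t in nhds (v $ i). \<phi> (\<bar>v $ i\<bar>) + ?s $ i * (\<bar>t\<bar> - \<bar>v $ i\<bar>) - ?e * \<bar>t - v $ i\<bar>
        \<le> \<phi> (\<bar>t\<bar>)"
      using penalty_first_order_expansion[OF pen, of ?e "v $ i"] \<open>0 < e\<close>
      by (simp add: vec_right_deriv_def abs_vec_def)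
    ultimately show ?thesis
      by (rule eventually_compose_filterlim[rotated])
  qed
  then have "\<forall>\<^sub>F u in nhds v. \<forall>i.
      \<phi> (\<bar>v $ i\<bar>) + ?s $ i * (\<bar>u $ i\<bar> - \<bar>v $ i\<bar>) - ?e * \<bar>u $ i - v $ i\<bar> \<le> \<phi> (\<bar>u $ i\<bar>)"
    by (simp add: eventually_all_finite)
  then show "\<forall>\<^sub>F u in nhds v. u \<in> C \<longrightarrow> f v + separable_sum \<phi> (\<bar>v\<bar>) - e * norm (u - v)
      \<le> f u + separable_sum \<phi> (\<bar>u\<bar>)"
  proof eventually_elim
    case (elim u)
    show ?case
    proof
      assume u: "u \<in> C"
      have "\<phi> (\<bar>v $ i\<bar>) + ?s $ i * (\<bar>u $ i\<bar> - \<bar>v $ i\<bar>) - ?e * norm (u - v) \<le> \<phi> (\<bar>u $ i\<bar>)" for i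
      proof -
        have "?e * \<bar>u $ i - v $ i\<bar> \<le> ?e * norm (u - v)"
          using component_le_norm_cart[of "u - v" i] \<open>0 < e\<close> by (intro mult_left_mono) auto
        then show ?thesis
          using elim[rule_format, of i] by linarith
      qed
      then have "(\<Sum>i\<in>UNIV. \<phi> (\<bar>v $ i\<bar>) + ?s $ i * (\<bar>u $ i\<bar> - \<bar>v $ i\<bar>) - ?e * norm (u - v))
          \<le> (\<Sum>i\<in>UNIV. \<phi> \<bar>u $ i\<bar>)"
        by (rule sum_mono)
      then have "separable_sum \<phi> (\<bar>v\<bar>) + (\<Sum>i\<in>UNIV. ?s $ i * \<bar>u $ i\<bar>)
          - (\<Sum>i\<in>UNIV. ?s $ i * \<bar>v $ i\<bar>) - e * norm (u - v) \<le> separable_sum \<phi> (\<bar>u\<bar>)"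
        by (simp add: separable_sum_def abs_vec_def sum.distrib sum_subtractf right_diff_distrib)
      moreover have "f v + g \<bullet> (u - v) \<le> f u"
        using convex_on_above_derivative[OF f_convex, of "\<lambda>h. h \<bullet> g" v u] grad
        by (simp add: gderiv_def inner_commute)
      ultimately show "f v + separable_sum \<phi> (\<bar>v\<bar>) - e * norm (u - v)
          \<le> f u + separable_sum \<phi> (\<bar>u\<bar>)"
        using minimal[OF u] by (simp add: inner_diff_right)
    qed
  qed
qed (simp_all add: objective_def indicator_ext_def)

section \<open>Convergence of the algorithm\<close>

theorem theorem4p1:
  fixes f :: "real ^ 'n \<Rightarrow> real"
    and gf :: "real ^ 'n \<Rightarrow> real ^ 'n"
    and C :: "(real ^ 'n) set"
    and \<phi> :: "real \<Rightarrow> real"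
    and L :: real
    and \<theta> :: "nat \<Rightarrow> real"
    and s x y z :: "nat \<Rightarrow> real ^ 'n"
  assumes f_convex: "convex_on UNIV f"
    and f_gradient: "\<And>u. GDERIV f u :> gf u"
    and f_C1: "continuous_on UNIV gf"
    and L_pos: "L > 0"
    and gradient_lipschitz: "L-lipschitz_on UNIV gf"
    and C_nonempty: "C \<noteq> {}"
    and C_closed: "closed C"
    and C_convex: "convex C"
    and penalty: "is_penalty \<phi>"
    and lev_bdd: "level_bounded (objective f C \<phi>)"
    and theta_range: "\<And>k. 0 < \<theta> k \<and> \<theta> k \<le> 1"
    and theta_sup: "(SUP k\<in>{1..}. (\<theta> k)\<^sup>2 * (1 - \<theta> (k - 1))\<^sup>2 - (\<theta> (k - 1))\<^sup>2) < 0"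
    and algorithm: "IRL1e2 L gf C \<phi> \<theta> s x y z"
  shows
    "(\<exists>h :: nat \<Rightarrow> real.
        (\<forall>k\<ge>1. potential L f C \<phi> (x k) (x (k - 1)) = ereal (h k)) \<and>
        (\<forall>k\<ge>1. h (Suc k) \<le> h k) \<and> convergent h) \<and>
     (\<lambda>k. Max {norm (z (Suc k) - x k), norm (z (Suc k) - y k), norm (z (Suc k) - z k)})
        \<longlonglongrightarrow> 0 \<and>
     bounded (range z) \<and>
     (\<forall>zstar r. strict_mono (r :: nat \<Rightarrow> nat) \<and> (z \<circ> r) \<longlonglongrightarrow> zstar \<longrightarrow>
        0 \<in> limiting_subdiff (objective f C \<phi>) zstar)"
proof -
  define F where "F u = f u + separable_sum \<phi> \<bar>u\<bar>" for u
  define h where "h k = F (x k) + L / 2 * (norm (x k - x (k - 1)))\<^sup>2" for k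
  define D where "D k = norm (z (Suc k) - x k)" for k
  have alg: "s (Suc k) = vec_right_deriv \<phi> \<bar>x k\<bar>"
      "y k = (1 - \<theta> k) *\<^sub>R x k + \<theta> k *\<^sub>R z k"
      "is_arg_min (irl_subproblem L (gf (y k)) (\<theta> k) (s (Suc k)) (y k) (z k))
         (\<lambda>u. u \<in> C) (z (Suc k))"
      "x (Suc k) = (1 - \<theta> k) *\<^sub>R x k + \<theta> k *\<^sub>R z (Suc k)" for k
    using algorithm unfolding IRL1e2_def by blast+
  have zC: "z (Suc k) \<in> C" for k
    using alg(3)[of k] by (simp add: is_arg_min_def)
  have xC: "x k \<in> C" for k
  proof (induction k)
    case (Suc k)
    then show ?case
      using C_convex zC theta_range[of k] by (auto simp: alg(4) intro!: convexD_alt)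
  qed (use algorithm in \<open>simp add: IRL1e2_def\<close>)
  have F_nonneg: "f u \<le> F u" for u
    using penalty by (auto simp: F_def is_penalty_def separable_sum_def abs_vec_def intro!: sum_nonneg)

  \<comment> \<open>The supremum is a genuine one, since the terms are at most \<open>1\<close>; so \<open>- \<delta>\<close> bounds each of them.\<close>
  define \<delta> where
    "\<delta> = - (SUP k\<in>{1..}. (\<theta> k)\<^sup>2 * (1 - \<theta> (k - 1))\<^sup>2 - (\<theta> (k - 1))\<^sup>2)"
  have "0 < \<delta>"
    using theta_sup by (simp add: \<delta>_def)
  have \<theta>_gap: "(\<theta> (Suc k))\<^sup>2 * (1 - \<theta> k)\<^sup>2 - (\<theta> k)\<^sup>2 \<le> - \<delta>" for k
  proof -
    have "(\<theta> k)\<^sup>2 * (1 - \<theta> (k - 1))\<^sup>2 - (\<theta> (k - 1))\<^sup>2 \<le> 1" for k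
    proof -
      have "(\<theta> k)\<^sup>2 * (1 - \<theta> (k - 1))\<^sup>2 \<le> 1"
        using theta_range[of k] theta_range[of "k - 1"]
        by (intro mult_le_one power_le_one) auto
      then show ?thesis
        by (simp add: add_increasing2 diff_le_eq)
    qed
    then have "bdd_above ((\<lambda>k. (\<theta> k)\<^sup>2 * (1 - \<theta> (k - 1))\<^sup>2 - (\<theta> (k - 1))\<^sup>2) ` {1..})"
      by (intro bdd_aboveI2)
    from cSUP_upper[OF _ this, of "Suc k"] show ?thesis
      by (simp add: \<delta>_def)
  qed

  have x_step: "norm (x (Suc k) - x k) = \<theta> k * D k" for k
  proof -
    have "x (Suc k) - x k = \<theta> k *\<^sub>R (z (Suc k) - x k)"
      by (simp add: alg(4) algebra_simps)
    then show ?thesis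
      using theta_range[of k] by (simp add: D_def)
  qed
  have xz: "norm (x (Suc k) - z (Suc k)) = (1 - \<theta> k) * D k" for k
  proof -
    have "x (Suc k) - z (Suc k) = (1 - \<theta> k) *\<^sub>R (x k - z (Suc k))"
      by (simp add: alg(4) algebra_simps)
    then show ?thesis
      using theta_range[of k] by (simp add: D_def norm_minus_commute)
  qed
  have h_descent: "h (Suc (Suc k)) + L / 2 * \<delta> * (D k)\<^sup>2 \<le> h (Suc k)" for k
  proof -
    have "h (Suc (Suc k)) \<le> F (x (Suc k)) + L / 2 * (D k)\<^sup>2 * ((\<theta> (Suc k))\<^sup>2 * (1 - \<theta> k)\<^sup>2)"
      using irl_step_descent[OF f_convex f_gradient gradient_lipschitz C_convex penalty _ _
          xC alg(2) alg(3)[unfolded alg(1)] alg(4), of "Suc k"] theta_range[of "Suc k"]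
      by (simp add: h_def F_def xz power_mult_distrib mult_ac)
    moreover have "h (Suc k) = F (x (Suc k)) + L / 2 * (D k)\<^sup>2 * (\<theta> k)\<^sup>2"
      by (simp add: h_def x_step power_mult_distrib)
    moreover have "L / 2 * (D k)\<^sup>2 * ((\<theta> (Suc k))\<^sup>2 * (1 - \<theta> k)\<^sup>2 - (\<theta> k)\<^sup>2)
        \<le> L / 2 * (D k)\<^sup>2 * (- \<delta>)"
      using \<theta>_gap[of k] L_pos by (intro mult_left_mono) auto
    then have "L / 2 * (D k)\<^sup>2 * ((\<theta> (Suc k))\<^sup>2 * (1 - \<theta> k)\<^sup>2) - L / 2 * (D k)\<^sup>2 * (\<theta> k)\<^sup>2
        \<le> - (L / 2 * \<delta> * (D k)\<^sup>2)"
      by (simp only: right_diff_distrib mult_minus_right mult_ac)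
    ultimately show ?thesis
      by linarith
  qed
  have h_decreasing: "h (Suc (Suc k)) \<le> h (Suc k)" for k
  proof -
    have "0 \<le> L / 2 * \<delta> * (D k)\<^sup>2"
      using L_pos \<open>0 < \<delta>\<close> by simp
    then show ?thesis
      using h_descent[of k] by linarith
  qed
  then have h_decseq: "decseq (\<lambda>k. h (Suc k))"
    by (simp add: decseq_Suc_iff)

  \<comment> \<open>Only \<open>h 1\<close> serves as level: the descent of \<open>h\<close> starts at index \<open>1\<close>, so \<open>x 0\<close> is added by hand.\<close>
  have "F (x (Suc k)) \<le> h 1" for k
  proof -
    have "F (x (Suc k)) \<le> h (Suc k)"
      using L_pos by (simp add: h_def)
    also have "\<dots> \<le> h 1"
      using decseqD[OF h_decseq, of 0 k] by simp
    finally show ?thesis .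
  qed
  then have "range (\<lambda>k. x (Suc k)) \<subseteq> {u. objective f C \<phi> u \<le> ereal (h 1)}"
    using xC by (auto simp: objective_def indicator_ext_def F_def)
  then have "bounded (range (\<lambda>k. x (Suc k)))"
    using lev_bdd bounded_subset by (auto simp: level_bounded_def)
  moreover have "range x \<subseteq> insert (x 0) (range (\<lambda>k. x (Suc k)))"
    by (metis (no_types, lifting) image_subsetI insertCI not0_implies_Suc rangeI)
  ultimately have x_bounded: "bounded (range x)"
    by (meson bounded_insert bounded_subset)

  have "continuous_on UNIV f"
    using f_gradient by (auto simp: gderiv_def continuous_on_eq_continuous_at
        intro: has_derivative_continuous)
  then have "compact (f ` closure (range x))"
    using x_bounded by (intro compact_continuous_image)
      (auto intro: continuous_on_subset)
  then obtain m where m: "\<And>k. m \<le> f (x k)"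
    using bounded_imp_bdd_below[OF compact_imp_bounded] closure_subset[of "range x"]
    unfolding bdd_below_def by (metis image_eqI rangeI subsetD)
  have "m \<le> h (Suc k)" for k
  proof -
    have "F (x (Suc k)) \<le> h (Suc k)"
      using L_pos by (simp add: h_def)
    then show ?thesis
      using m[of "Suc k"] F_nonneg[of "x (Suc k)"] by linarith
  qed
  then obtain h_lim where h_lim: "(\<lambda>k. h (Suc k)) \<longlonglongrightarrow> h_lim"
    using decseq_convergent[OF h_decseq] by metis
  then have h_convergent: "convergent h"
    using convergent_Suc_iff convergentI by blast
  have potential_eq: "potential L f C \<phi> (x k) (x (k - 1)) = ereal (h k)" for k
    using xC by (simp add: potential_def indicator_ext_def h_def F_def)

  \<comment> \<open>The decrement of the convergent sequence \<open>h\<close> dominates a fixed multiple of \<open>(D k)\<^sup>2\<close>.\<close>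
  have D_lim: "D \<longlonglongrightarrow> 0"
  proof -
    have "(\<lambda>k. h (Suc k) - h (Suc (Suc k))) \<longlonglongrightarrow> 0"
      using tendsto_diff[OF h_lim LIMSEQ_Suc[OF h_lim]] by simp
    then have "(\<lambda>k. (h (Suc k) - h (Suc (Suc k))) / (L / 2 * \<delta>)) \<longlonglongrightarrow> 0"
      by (rule tendsto_divide_zero)
    moreover have "norm ((D k)\<^sup>2) \<le> (h (Suc k) - h (Suc (Suc k))) / (L / 2 * \<delta>)" for k
      using h_descent[of k] L_pos \<open>0 < \<delta>\<close> by (simp add: field_simps)
    ultimately have "(\<lambda>k. (D k)\<^sup>2) \<longlonglongrightarrow> 0"
      by (intro Lim_null_comparison[where f = "\<lambda>k. (D k)\<^sup>2"]) auto
    then show ?thesis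
      by simp
  qed
  have xz_lim: "(\<lambda>k. x k - z k) \<longlonglongrightarrow> 0"
  proof (rule LIMSEQ_imp_Suc)
    have "norm (x (Suc k) - z (Suc k)) \<le> D k" for k
      using theta_range[of k] by (simp add: xz D_def mult_left_le_one_le)
    then show "(\<lambda>k. x (Suc k) - z (Suc k)) \<longlonglongrightarrow> 0"
      by (intro Lim_null_comparison[OF _ D_lim]) auto
  qed
  have zx_lim: "(\<lambda>k. z (Suc k) - x k) \<longlonglongrightarrow> 0"
    using D_lim unfolding D_def by (rule tendsto_norm_zero_cancel)
  have xy_lim: "(\<lambda>k. x k - y k) \<longlonglongrightarrow> 0"
  proof (rule Lim_null_comparison)
    have "x k - y k = \<theta> k *\<^sub>R (x k - z k)" for k
      by (simp add: alg(2) algebra_simps)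
    then have "norm (x k - y k) \<le> norm (x k - z k)" for k
      using theta_range[of k] by (simp add: mult_left_le_one_le)
    then show "\<forall>\<^sub>F k in sequentially. norm (x k - y k) \<le> norm (x k - z k)"
      by simp
  qed (rule tendsto_norm_zero[OF xz_lim])
  have zy_lim: "(\<lambda>k. z (Suc k) - y k) \<longlonglongrightarrow> 0"
    using tendsto_add[OF zx_lim xy_lim] by simp
  have zz_lim: "(\<lambda>k. z (Suc k) - z k) \<longlonglongrightarrow> 0"
    using tendsto_add[OF zx_lim xz_lim] by simp
  have max_lim: "(\<lambda>k. Max {norm (z (Suc k) - x k), norm (z (Suc k) - y k), norm (z (Suc k) - z k)})
      \<longlonglongrightarrow> 0"
    using tendsto_max[OF tendsto_norm_zero[OF zx_lim]
        tendsto_max[OF tendsto_norm_zero[OF zy_lim] tendsto_norm_zero[OF zz_lim]]]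
    by simp

  have z_bounded: "bounded (range z)"
  proof -
    have "bounded (range (\<lambda>k. x k - (x k - z k)))"
      using x_bounded convergent_imp_bounded[OF xz_lim] by (rule bounded_minus_comp)
    then show ?thesis
      by simp
  qed

  have stationary: "0 \<in> limiting_subdiff (objective f C \<phi>) zstar"
    if r: "strict_mono (r :: nat \<Rightarrow> nat)" "(z \<circ> r) \<longlonglongrightarrow> zstar" for zstar r
  proof -
    \<comment> \<open>The subsequence \<open>z (r j)\<close> is produced by step \<open>r j - 1\<close>; starting at \<open>r 1 \<ge> 1\<close> makes this
      predecessor exist.\<close>
    define q where "q j = r (Suc j) - 1" for j
    have q: "Suc (q j) = r (Suc j)" for j
      using strict_mono_imp_increasing[OF r(1), of "Suc j"] by (simp add: q_def)
    have "j \<le> q j" for j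
      using strict_mono_imp_increasing[OF r(1), of "Suc j"] by (simp add: q_def)
    then have q_lim: "filterlim q at_top sequentially"
      by (intro filterlim_at_top_mono[OF filterlim_ident]) auto
    have zq: "(\<lambda>j. z (Suc (q j))) \<longlonglongrightarrow> zstar"
      using LIMSEQ_Suc[OF r(2)] by (simp add: q)
    have xq: "(\<lambda>j. x (q j)) \<longlonglongrightarrow> zstar"
      using tendsto_diff[OF zq filterlim_compose[OF zx_lim q_lim]] by simp
    have yq: "(\<lambda>j. y (q j)) \<longlonglongrightarrow> zstar"
      using tendsto_diff[OF zq filterlim_compose[OF zy_lim q_lim]] by simp
    have gq: "(\<lambda>j. gf (y (q j))) \<longlonglongrightarrow> gf zstar"
      using f_C1 yq by (rule continuous_on_tendsto_compose) auto
    have sq: "(\<lambda>j. s (Suc (q j)) $ i) \<longlonglongrightarrow> vec_right_deriv \<phi> \<bar>zstar\<bar> $ i" for i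
      using continuous_on_tendsto_compose[OF continuous_on_right_deriv_penalty[OF penalty],
          of "\<lambda>j. \<bar>x (q j) $ i\<bar>" "\<bar>zstar $ i\<bar>"] tendsto_rabs[OF tendsto_vec_nth[OF xq]]
      by (simp add: alg(1) vec_right_deriv_def abs_vec_def)
    have zstar: "zstar \<in> C"
      using closed_sequentially[OF C_closed _ zq] zC by blast
    have "gf zstar \<bullet> zstar + (\<Sum>i\<in>UNIV. vec_right_deriv \<phi> \<bar>zstar\<bar> $ i * \<bar>zstar $ i\<bar>)
        \<le> gf zstar \<bullet> u + (\<Sum>i\<in>UNIV. vec_right_deriv \<phi> \<bar>zstar\<bar> $ i * \<bar>u $ i\<bar>)" if u: "u \<in> C" for u
    proof -
      let ?E = "\<lambda>k. L * \<theta> k * ((z (Suc k) - z k) \<bullet> (u - z (Suc k)))"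
      have "0 \<le> s (Suc k) $ i" for k i
        using right_deriv_penalty_nonneg[OF penalty]
        by (simp add: alg(1) vec_right_deriv_def abs_vec_def)
      then have ineq: "gf (y k) \<bullet> z (Suc k) + (\<Sum>i\<in>UNIV. s (Suc k) $ i * \<bar>z (Suc k) $ i\<bar>)
          \<le> gf (y k) \<bullet> u + (\<Sum>i\<in>UNIV. s (Suc k) $ i * \<bar>u $ i\<bar>) + ?E k" for k
        by (rule irl_minimizer_inequality[OF C_convex _ alg(3) u])
      have "(\<lambda>j. (z (Suc (q j)) - z (q j)) \<bullet> (u - z (Suc (q j)))) \<longlonglongrightarrow> 0 \<bullet> (u - zstar)"
        by (intro tendsto_intros filterlim_compose[OF zz_lim q_lim] zq)
      then have "(\<lambda>j. L * norm ((z (Suc (q j)) - z (q j)) \<bullet> (u - z (Suc (q j))))) \<longlonglongrightarrow> 0"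
        by (auto intro!: tendsto_mult_right_zero tendsto_norm_zero simp del: real_norm_def)
      moreover have "norm (?E k) \<le> L * norm ((z (Suc k) - z k) \<bullet> (u - z (Suc k)))" for k
        using theta_range[of k] L_pos
        by (simp add: abs_mult mult.assoc mult_left_le_one_le)
      ultimately have "(\<lambda>j. ?E (q j)) \<longlonglongrightarrow> 0"
        by (intro Lim_null_comparison[where f = "\<lambda>j. ?E (q j)"]) auto
      then have rhs: "(\<lambda>j. gf (y (q j)) \<bullet> u + (\<Sum>i\<in>UNIV. s (Suc (q j)) $ i * \<bar>u $ i\<bar>) + ?E (q j))
          \<longlonglongrightarrow> gf zstar \<bullet> u + (\<Sum>i\<in>UNIV. vec_right_deriv \<phi> \<bar>zstar\<bar> $ i * \<bar>u $ i\<bar>) + 0"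
        by (intro tendsto_intros gq sq)
      have lhs: "(\<lambda>j. gf (y (q j)) \<bullet> z (Suc (q j))
            + (\<Sum>i\<in>UNIV. s (Suc (q j)) $ i * \<bar>z (Suc (q j)) $ i\<bar>))
          \<longlonglongrightarrow> gf zstar \<bullet> zstar + (\<Sum>i\<in>UNIV. vec_right_deriv \<phi> \<bar>zstar\<bar> $ i * \<bar>zstar $ i\<bar>)"
        by (intro tendsto_intros gq sq zq)
      show ?thesis
        using LIMSEQ_le[OF lhs rhs exI[of _ 0]] ineq by (simp only: add_0_right simp_thms)
    qed
    then have "0 \<in> regular_subdiff (objective f C \<phi>) zstar"
      by (rule linearized_minimizer_stationary[OF f_convex f_gradient penalty zstar])
    then show ?thesis
      using regular_subdiff_subset_limiting_subdiff by blast
  qed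

  have "\<exists>h :: nat \<Rightarrow> real.
      (\<forall>k\<ge>1. potential L f C \<phi> (x k) (x (k - 1)) = ereal (h k)) \<and>
      (\<forall>k\<ge>1. h (Suc k) \<le> h k) \<and> convergent h"
  proof (intro exI[of _ h] conjI allI impI potential_eq h_convergent)
    fix k :: nat
    assume "1 \<le> k"
    then show "h (Suc k) \<le> h k"
      using h_decreasing[of "k - 1"] by simp
  qed
  with max_lim z_bounded stationary show ?thesis
    by blast
qed

end
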